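(* Let $a\in[0,1]$ and let $(R_n)_{n\geq 1}$ be the sequence of polynomials defined by $R_1(x)=x$ and, for $n\geq 1$, $R_{n+1}(x)=xR_n(x)-\frac{a}{n}(1-x^2)R_n'(x)$. Then for all $n\geq 1$, $$R_n'(1)=\frac{\Gamma(n+1)\Gamma(2a)-\Gamma(n+2a)}{(1-2a)\Gamma(2a)\Gamma(n)},$$ where for $a=0$ and $a=\frac12$ the right-hand side is understood as its limit as the parameter tends to $0$, respectively to $\frac12$. Moreover, as $n\to\infty$, $$R_n'(1)\sim\begin{cases}\dfrac{n}{1-2a}&\text{if }a<\frac12,\\[2mm] n\ln(n)&\text{if }a=\frac12,\\[2mm] \dfrac{n^{2a}}{(2a-1)\Gamma(2a)}&\text{if }a>\frac12.\end{cases}$$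
   Context: $\Gamma$ denotes the Euler Gamma function, and $u_n\sim v_n$ means $u_n/v_n\to 1$ as $n\to\infty$. *)

theory Defs
  imports
    "HOL-Analysis.Gamma_Function"
    "HOL-Computational_Algebra.Polynomial"
    "HOL-Library.Landau_Symbols"
begin

(* The raw formula in the parameter b. At b = 0 and b = 1/2 it is 0/0 (in HOL: Gamma 0 = 0
   and x / 0 = 0), so there only its limit as the parameter tends to b is meaningful. *)
definition deriv_formula :: "nat \<Rightarrow> real \<Rightarrow> real" where
  "deriv_formula n b =
     (Gamma (real n + 1) * Gamma (2 * b) - Gamma (real n + 2 * b))
       / ((1 - 2 * b) * Gamma (2 * b) * Gamma (real n))"

end

theory Submission imports Defs "HOL-Real_Asymp.Real_Asymp" begin

text \<open>
  Evaluating the recurrence and its derivative at 1 gives \<open>R n (1) = 1\<close> and a scalar recurrence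
  for \<open>R n '(1)\<close>, whose coefficients are polynomial in the parameter. The Gamma quotient solves it
  away from its singularities, and continuity in the parameter covers \<open>a = 0\<close> and \<open>a = 1/2\<close>.
  The asymptotics come from Euler's limit for Gamma, and at \<open>a = 1/2\<close> from the solution
  \<open>n * harm n\<close>.
\<close>

(* The step from 0 involves the junk value 2 * b / 0 = 0, which is harmless since the
   initial value is 0. *)
primrec slope :: "real \<Rightarrow> nat \<Rightarrow> real" where
  "slope b 0 = 0"
| "slope b (Suc n) = 1 + (1 + 2 * b / real n) * slope b n"

lemma isCont_slope: "isCont (\<lambda>b. slope b n) a"
proof (induction n)
  case (Suc n)
  then show ?case by (cases "n = 0") (auto intro!: continuous_intros)
qed simp

lemma slope_0: "slope 0 n = real n"
  by (induction n) auto

text \<open>At this parameter the step factor is \<open>(n + 1) / n\<close>, so dividing the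
  recurrence by \<open>n + 1\<close> makes it telescope: \<open>slope (1/2) n / n\<close> grows by
  \<open>1 / (n + 1)\<close>.\<close>

lemma slope_half: "slope (1/2) n = real n * harm n"
proof (induction n)
  case (Suc n)
  then show ?case
    by (cases "n = 0") (simp_all add: harm_Suc harm_expand field_simps)
qed simp

text \<open>A particular solution of the recurrence is \<open>n / (1 - 2 * b)\<close>, and
  \<open>pochhammer (2 * b) n / fact (n - 1)\<close> solves the homogeneous one; the value 1 at
  \<open>n = 1\<close> fixes the combination. Unlike the Gamma quotient, this form also makes sense
  where \<open>2 * b\<close> is a pole of Gamma.\<close>

lemma slope_closed_form:
  assumes "b \<noteq> 1/2"
  shows "slope b (Suc n) = (real (Suc n) - pochhammer (2 * b) (Suc n) / fact n) / (1 - 2 * b)"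
proof (induction n)
  case 0
  then show ?case using assms by (simp add: field_simps)
next
  case (Suc n)
  have nz: "1 - 2 * b \<noteq> 0" using assms by simp
  define p :: real where "p = pochhammer (2 * b) (Suc n) / fact n"
  have "pochhammer (2 * b) (Suc (Suc n)) / fact (Suc n) = p * (1 + 2 * b / real (Suc n))"
    unfolding p_def pochhammer_Suc[of _ "Suc n"] fact_Suc by (simp add: field_simps)
  moreover have "slope b (Suc (Suc n)) = 1 + (1 + 2 * b / real (Suc n)) * ((real (Suc n) - p) / (1 - 2 * b))"
    using Suc by (simp add: p_def)
  moreover have "\<dots> = (real (Suc (Suc n)) - p * (1 + 2 * b / real (Suc n))) / (1 - 2 * b)"
    using nz by (simp add: divide_simps) (simp add: algebra_simps)
  ultimately show ?case by simp
qed

lemma slope_eq_deriv_formula: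
  assumes "b \<noteq> 1/2" and "2 * b \<notin> \<int>\<^sub>\<le>\<^sub>0" and "n \<ge> 1"
  shows "slope b n = deriv_formula n b"
proof -
  obtain m where m: "n = Suc m" using \<open>n \<ge> 1\<close> by (cases n) auto
  have g: "Gamma (2 * b) \<noteq> 0" using assms(2) by (simp add: Gamma_eq_zero_iff)
  have "Gamma (real n + 2 * b) = pochhammer (2 * b) n * Gamma (2 * b)"
    using pochhammer_Gamma[OF assms(2), of n] g by (simp add: field_simps)
  moreover have "Gamma (real n + 1) = real n * fact m" "Gamma (real n) = fact m"
    using Gamma_fact[of n, where 'a = real] Gamma_fact[of m, where 'a = real] m
    by (simp_all add: add.commute)
  ultimately have "deriv_formula n b =
      (real n * fact m - pochhammer (2 * b) n) * Gamma (2 * b) / ((1 - 2 * b) * fact m * Gamma (2 * b))"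
    by (simp add: deriv_formula_def algebra_simps)
  also have "\<dots> = (real n - pochhammer (2 * b) n / fact m) / (1 - 2 * b)"
    using g assms(1) by (simp add: divide_simps)
  finally show ?thesis using slope_closed_form[OF assms(1), of m] m by simp
qed

lemma tendsto_deriv_formula:
  assumes "a = 0 \<or> a = 1/2" and "n \<ge> 1"
  shows "(deriv_formula n \<longlongrightarrow> slope a n) (at a)"
proof (rule Lim_transform_eventually)
  show "((\<lambda>b. slope b n) \<longlongrightarrow> slope a n) (at a)"
    using isCont_slope by (simp add: isCont_def)
  \<comment> \<open>With radius 1/4, \<open>2 * b\<close> stays within 1/2 of 0 or of 1 and differs
    from that centre, so it is neither a pole of Gamma nor equal to 1.\<close>
  have "eventually (\<lambda>b. b \<in> {a - 1/4<..<a + 1/4} - {a}) (at a)"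
    by (rule eventually_at_in_open) auto
  then show "eventually (\<lambda>b. slope b n = deriv_formula n b) (at a)"
  proof eventually_elim
    case (elim b)
    have "2 * b \<notin> \<int>\<^sub>\<le>\<^sub>0"
    proof
      assume "2 * b \<in> \<int>\<^sub>\<le>\<^sub>0"
      then obtain k where "2 * b = - real k" by (auto elim!: nonpos_Ints_cases')
      then show False using elim assms(1) by (cases k) auto
    qed
    moreover have "b \<noteq> 1/2" using elim assms(1) by auto
    ultimately show ?case using slope_eq_deriv_formula \<open>n \<ge> 1\<close> by blast
  qed
qed

text \<open>This isolates the growth rate \<open>n powr (2 * a)\<close> of the Pochhammer term: the
  remaining factor \<open>Gamma_series' (2 * a) n\<close> tends to
  \<open>Gamma (2 * a)\<close>.\<close>

lemma slope_eq_Gamma_series':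
  assumes "0 < a" and "a \<noteq> 1/2" and "n \<ge> 1"
  shows "slope a n = (real n - real n powr (2 * a) / Gamma_series' (2 * a) n) / (1 - 2 * a)"
proof -
  obtain m where m: "n = Suc m" using \<open>n \<ge> 1\<close> by (cases n) auto
  have "pochhammer (2 * a) n > 0" using assms by (intro pochhammer_pos) auto
  then have "pochhammer (2 * a) n / fact m = real n powr (2 * a) / Gamma_series' (2 * a) n"
    using m by (simp add: Gamma_series'_def powr_def field_simps)
  then show ?thesis using slope_closed_form[OF assms(2), of m] m by simp
qed

text \<open>Since \<open>2 * a < 1\<close>, the linear term of the closed form dominates the
  power.\<close>

lemma slope_asymp_less_half:
  assumes "0 \<le> a" and "a < 1/2"
  shows "slope a \<sim>[sequentially] (\<lambda>n. real n / (1 - 2 * a))"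
proof (cases "a = 0")
  case True
  then have "slope a = real" by (auto simp: slope_0)
  then show ?thesis using True by simp
next
  case False
  with assms have a: "0 < a" "a \<noteq> 1/2" by auto
  have G: "Gamma (2 * a) \<noteq> 0" using a Gamma_real_pos[of "2 * a"] by linarith
  have "(\<lambda>n. real n powr (2 * a - 1)) \<longlonglongrightarrow> 0"
    using assms by real_asymp
  then have "(\<lambda>n. 1 - real n powr (2 * a - 1) / Gamma_series' (2 * a) n) \<longlonglongrightarrow> 1 - 0 / Gamma (2 * a)"
    by (intro tendsto_intros Gamma_series'_LIMSEQ G)
  then have lim: "(\<lambda>n. 1 - real n powr (2 * a - 1) / Gamma_series' (2 * a) n) \<longlonglongrightarrow> 1" by simp
  show ?thesis
  proof (rule asymp_equivI', rule Lim_transform_eventually[OF lim])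
    show "eventually (\<lambda>n. 1 - real n powr (2 * a - 1) / Gamma_series' (2 * a) n
        = slope a n / (real n / (1 - 2 * a))) sequentially"
      using eventually_ge_at_top[of 1]
    proof eventually_elim
      case (elim n)
      have "slope a n * (1 - 2 * a) = real n - real n powr (2 * a) / Gamma_series' (2 * a) n"
        using slope_eq_Gamma_series'[OF a elim] assms by simp
      then have "slope a n / (real n / (1 - 2 * a))
          = (real n - real n powr (2 * a) / Gamma_series' (2 * a) n) / real n"
        by simp
      then show ?case
        using elim by (simp add: powr_diff diff_divide_distrib)
    qed
  qed
qed

text \<open>The difference \<open>harm n - ln n\<close> converges to the Euler-Mascheroni constant,
  so it vanishes after division by \<open>ln n\<close>.\<close>

lemma slope_asymp_half: "slope (1/2) \<sim>[sequentially] (\<lambda>n. real n * ln (real n))"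
proof -
  have "(\<lambda>n. (harm n - ln (real n)) / ln (real n) + 1) \<longlonglongrightarrow> 0 + 1"
    by (intro tendsto_add tendsto_const tendsto_divide_0[OF euler_mascheroni_LIMSEQ]
        filterlim_at_top_imp_at_infinity) real_asymp
  then have lim: "(\<lambda>n. (harm n - ln (real n)) / ln (real n) + 1) \<longlonglongrightarrow> 1" by simp
  show ?thesis
  proof (rule asymp_equivI', rule Lim_transform_eventually[OF lim])
    show "eventually (\<lambda>n. (harm n - ln (real n)) / ln (real n) + 1
        = slope (1/2) n / (real n * ln (real n))) sequentially"
      using eventually_ge_at_top[of 2]
    proof eventually_elim
      case (elim n)
      then have "ln (real n) > 0" by simp
      then show ?case using elim unfolding slope_half by (simp add: field_simps)
    qed
  qed
qed

text \<open>Now \<open>2 * a > 1\<close>, so the power dominates the linear term, which contributes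
  only a multiple of \<open>n powr (1 - 2 * a)\<close> to the ratio.\<close>

lemma slope_asymp_greater_half:
  assumes "a > 1/2"
  shows "slope a \<sim>[sequentially] (\<lambda>n. real n powr (2 * a) / ((2 * a - 1) * Gamma (2 * a)))"
proof -
  have a: "0 < a" "a \<noteq> 1/2" using assms by auto
  define G where "G = Gamma (2 * a)"
  have G: "G \<noteq> 0" using a Gamma_real_pos[of "2 * a"] unfolding G_def by linarith
  have "(\<lambda>n. real n powr (1 - 2 * a)) \<longlonglongrightarrow> 0"
    using assms by real_asymp
  then have "(\<lambda>n. G / Gamma_series' (2 * a) n - G * real n powr (1 - 2 * a)) \<longlonglongrightarrow> G / G - G * 0"
    using G unfolding G_def by (intro tendsto_intros Gamma_series'_LIMSEQ)
  then have lim: "(\<lambda>n. G / Gamma_series' (2 * a) n - G * real n powr (1 - 2 * a)) \<longlonglongrightarrow> 1"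
    using G by simp
  show ?thesis unfolding G_def[symmetric]
  proof (rule asymp_equivI', rule Lim_transform_eventually[OF lim])
    show "eventually (\<lambda>n. G / Gamma_series' (2 * a) n - G * real n powr (1 - 2 * a)
        = slope a n / (real n powr (2 * a) / ((2 * a - 1) * G))) sequentially"
      using eventually_ge_at_top[of 1]
    proof eventually_elim
      case (elim n)
      define p where "p = real n powr (2 * a)"
      define g where "g = inverse (Gamma_series' (2 * a) n)"
      have p: "p > 0" using elim by (simp add: p_def)
      have "slope a n = (real n - p * g) / (1 - 2 * a)"
        using slope_eq_Gamma_series'[OF a elim] by (simp add: p_def g_def divide_inverse)
      then have "slope a n * (2 * a - 1) = p * g - real n"
        using assms by (simp add: divide_simps) (simp add: algebra_simps)
      then have "slope a n / (p / ((2 * a - 1) * G)) = (p * g - real n) * G / p"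
        by (simp flip: mult.assoc)
      also have "\<dots> = G * g - G * (real n / p)"
        using p by (simp add: field_simps)
      finally have "slope a n / (p / ((2 * a - 1) * G)) = G * g - G * (real n / p)" .
      moreover have "real n powr (1 - 2 * a) = real n / p"
        using elim by (simp add: p_def powr_diff)
      ultimately show ?case by (simp add: p_def g_def divide_inverse)
    qed
  qed
qed

text \<open>The factor \<open>1 - x^2\<close> vanishes at 1, which removes the second derivative of
  \<open>R n\<close>; its own derivative there is -2, whence the coefficient
  \<open>2 * a / n\<close>. The value of \<open>R n\<close> at 1 supplies the summand 1 and is
  therefore carried through the induction.\<close>

lemma poly_pderiv_at_1_eq_slope:
  fixes R :: "nat \<Rightarrow> real poly"
  assumes "R 1 = [:0, 1:]"
    and "\<And>n. n \<ge> 1 \<Longrightarrow>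
           R (n + 1) = [:0, 1:] * R n - smult (a / real n) ((1 - [:0, 1:] ^ 2) * pderiv (R n))"
    and "n \<ge> 1"
  shows "poly (R n) 1 = 1 \<and> poly (pderiv (R n)) 1 = slope a n"
  using \<open>n \<ge> 1\<close>
proof (induction n rule: dec_induct)
  case base
  then show ?case using assms(1) by (simp add: pderiv_pCons)
next
  case (step n)
  have "R (Suc n) = [:0, 1:] * R n - smult (a / real n) ((1 - [:0, 1:] ^ 2) * pderiv (R n))"
    using assms(2)[of n] step by simp
  then show ?case using step.IH
    by (simp add: pderiv_diff pderiv_mult pderiv_smult pderiv_pCons power2_eq_square) (simp add: algebra_simps)
qed

theorem proposition4:
  fixes a :: real and R :: "nat \<Rightarrow> real poly"
  assumes "0 \<le> a" and "a \<le> 1"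
    and "R 1 = [:0, 1:]"
    and "\<And>n. n \<ge> 1 \<Longrightarrow>
           R (n + 1) = [:0, 1:] * R n - smult (a / real n) ((1 - [:0, 1:] ^ 2) * pderiv (R n))"
  shows "(\<forall>n\<ge>1. if a = 0 \<or> a = 1 / 2
                 then (deriv_formula n \<longlongrightarrow> poly (pderiv (R n)) 1) (at a)
                 else poly (pderiv (R n)) 1 = deriv_formula n a)
       \<and> (\<lambda>n. poly (pderiv (R n)) 1) \<sim>[sequentially]
           (\<lambda>n. if a < 1 / 2 then real n / (1 - 2 * a)
                else if a = 1 / 2 then real n * ln (real n)
                else real n powr (2 * a) / ((2 * a - 1) * Gamma (2 * a)))"
proof -
  have eq: "poly (pderiv (R n)) 1 = slope a n" if "n \<ge> 1" for n
    using poly_pderiv_at_1_eq_slope[OF assms(3,4) that] by simp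
  have "2 * a \<notin> \<int>\<^sub>\<le>\<^sub>0" if "a \<noteq> 0"
    using that assms(1) by (auto elim!: nonpos_Ints_cases')
  then have "\<forall>n\<ge>1. if a = 0 \<or> a = 1 / 2
                 then (deriv_formula n \<longlongrightarrow> poly (pderiv (R n)) 1) (at a)
                 else poly (pderiv (R n)) 1 = deriv_formula n a"
    using tendsto_deriv_formula slope_eq_deriv_formula eq by simp
  moreover have "slope a \<sim>[sequentially]
           (\<lambda>n. if a < 1 / 2 then real n / (1 - 2 * a)
                else if a = 1 / 2 then real n * ln (real n)
                else real n powr (2 * a) / ((2 * a - 1) * Gamma (2 * a)))"
  proof (cases a "1/2 :: real" rule: linorder_cases)
    case less
    then show ?thesis using slope_asymp_less_half[OF assms(1)] by simp
  next
    case equal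
    show ?thesis unfolding equal using slope_asymp_half by simp
  next
    case greater
    then show ?thesis using slope_asymp_greater_half by simp
  qed
  \<comment> \<open>The two sequences are only known to agree from 1 on, because \<open>R 0\<close>
    is arbitrary.\<close>
  moreover have "(\<lambda>n. poly (pderiv (R n)) 1) \<sim>[sequentially] slope a"
    by (rule asymp_equiv_refl_ev) (use eventually_ge_at_top[of 1] in \<open>eventually_elim, simp add: eq\<close>)
  ultimately show ?thesis
    by (blast intro: asymp_equiv_trans)
qed

end
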